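(* Let $H$ be a Hopf algebra over a field $k$. The poset $(\mathrm{Quot}_{gen}(H),\succeq)$ of quotients of $H$ by coideal right ideals is a complete lattice. When $H$ is finite dimensional this lattice is algebraic and dually algebraic.
   Context: $\mathrm{Quot}_{gen}(H)=\{H/I: I\text{ a coideal and a right ideal of }H\}$, ordered by $H/I\succeq H/J$ iff $I\subseteq J$ (so it is dually isomorphic to the poset of coideal right ideals ordered by inclusion). A lattice is complete if every subset has a supremum and an infimum. An element $z$ of a lattice $\Lambda$ is compact if whenever $z\le\bigvee S$ for a subset $S\subseteq\Lambda$ there is a finite $S_f\subseteq S$ with $z\le\bigvee S_f$. A lattice is algebraic if it is complete and every element is a supremum of compact elements; it is dually algebraic if the lattice with the dual order is algebraic. *)

theory Defs
  imports Complex_Main "HOL-Algebra.Complete_Lattice" "HOL-Library.Poly_Mapping"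
begin

section \<open>Quotients of vector spaces\<close>

definition coset :: "'v::ab_group_add set \<Rightarrow> 'v \<Rightarrow> 'v set"
  where "coset N x = {x + n | n. n \<in> N}"

definition quotient_space :: "'v::ab_group_add set \<Rightarrow> 'v set set"
  where "quotient_space N = range (coset N)"

definition rep :: "'v set \<Rightarrow> 'v"
  where "rep C = (SOME x. x \<in> C)"


section \<open>Free vector spaces\<close>

text \<open>
  The free \<open>'k\<close>-vector space on the set of all elements of \<open>'x\<close> is the type \<open>'x \<Rightarrow>\<^sub>0 'k\<close> of
  finitely supported functions.
\<close>

definition fscale :: "'k::field \<Rightarrow> ('x \<Rightarrow>\<^sub>0 'k) \<Rightarrow> ('x \<Rightarrow>\<^sub>0 'k)"
  where "fscale c p = Poly_Mapping.map ((*) c) p"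

abbreviation gen :: "'x \<Rightarrow> ('x \<Rightarrow>\<^sub>0 'k::field)"
  where "gen x \<equiv> Poly_Mapping.single x 1"

text \<open>The linear extension of a function on generators to the free vector space; the first
  argument is the scalar multiplication of the codomain.\<close>

definition lin_ext :: "('k::field \<Rightarrow> 'v \<Rightarrow> 'v) \<Rightarrow> ('x \<Rightarrow> 'v) \<Rightarrow> ('x \<Rightarrow>\<^sub>0 'k) \<Rightarrow> 'v::ab_group_add"
  where "lin_ext s f p = (\<Sum>x\<in>Poly_Mapping.keys p. s (Poly_Mapping.lookup p x) (f x))"


section \<open>Tensor powers of a vector space\<close>

text \<open>
  \<open>H \<otimes> H\<close> and \<open>H \<otimes> H \<otimes> H\<close> are the free vector spaces on \<open>H \<times> H\<close> and \<open>H \<times> H \<times> H\<close> modulo the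
  multilinearity relations. The vector space \<open>H\<close> is the whole type \<open>'h\<close>, with
  scalar multiplication \<open>s\<close>. Maps out of a tensor power are written down on a
  representative; the lemmas below show that its choice is immaterial.
\<close>

definition tensor2_rel :: "('k::field \<Rightarrow> 'h \<Rightarrow> 'h) \<Rightarrow> ('h \<times> 'h::ab_group_add \<Rightarrow>\<^sub>0 'k) set"
  where "tensor2_rel s = module.span fscale
    ({gen (a + a', b) - gen (a, b) - gen (a', b) | a a' b. True} \<union>
     {gen (a, b + b') - gen (a, b) - gen (a, b') | a b b'. True} \<union>
     {gen (s c a, b) - fscale c (gen (a, b)) | c a b. True} \<union>
     {gen (a, s c b) - fscale c (gen (a, b)) | c a b. True})"

definition tensor3_rel :: "('k::field \<Rightarrow> 'h \<Rightarrow> 'h) \<Rightarrow> ('h \<times> 'h \<times> 'h::ab_group_add \<Rightarrow>\<^sub>0 'k) set"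
  where "tensor3_rel s = module.span fscale
    ({gen (a + a', b, d) - gen (a, b, d) - gen (a', b, d) | a a' b d. True} \<union>
     {gen (a, b + b', d) - gen (a, b, d) - gen (a, b', d) | a b b' d. True} \<union>
     {gen (a, b, d + d') - gen (a, b, d) - gen (a, b, d') | a b d d'. True} \<union>
     {gen (s c a, b, d) - fscale c (gen (a, b, d)) | c a b d. True} \<union>
     {gen (a, s c b, d) - fscale c (gen (a, b, d)) | c a b d. True} \<union>
     {gen (a, b, s c d) - fscale c (gen (a, b, d)) | c a b d. True})"

type_synonym ('k, 'h) tensor2 = "('h \<times> 'h \<Rightarrow>\<^sub>0 'k) set"
type_synonym ('k, 'h) tensor3 = "('h \<times> 'h \<times> 'h \<Rightarrow>\<^sub>0 'k) set"

definition tensor2_space :: "('k::field \<Rightarrow> 'h \<Rightarrow> 'h::ab_group_add) \<Rightarrow> ('k, 'h) tensor2 set"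
  where "tensor2_space s = quotient_space (tensor2_rel s)"

definition tensor2_class ::
    "('k::field \<Rightarrow> 'h \<Rightarrow> 'h) \<Rightarrow> ('h \<times> 'h \<Rightarrow>\<^sub>0 'k) \<Rightarrow> ('k, 'h::ab_group_add) tensor2"
  where "tensor2_class s = coset (tensor2_rel s)"

definition tensor3_class ::
    "('k::field \<Rightarrow> 'h \<Rightarrow> 'h) \<Rightarrow> ('h \<times> 'h \<times> 'h \<Rightarrow>\<^sub>0 'k) \<Rightarrow> ('k, 'h::ab_group_add) tensor3"
  where "tensor3_class s = coset (tensor3_rel s)"

definition tensor2_add ::
    "('k::field \<Rightarrow> 'h \<Rightarrow> 'h) \<Rightarrow> ('k, 'h::ab_group_add) tensor2 \<Rightarrow> ('k, 'h) tensor2 \<Rightarrow> ('k, 'h) tensor2"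
  where "tensor2_add s u v = tensor2_class s (rep u + rep v)"

definition tensor2_scale ::
    "('k::field \<Rightarrow> 'h \<Rightarrow> 'h) \<Rightarrow> 'k \<Rightarrow> ('k, 'h::ab_group_add) tensor2 \<Rightarrow> ('k, 'h) tensor2"
  where "tensor2_scale s c u = tensor2_class s (fscale c (rep u))"

text \<open>\<open>(a \<otimes> b) (a' \<otimes> b') = a a' \<otimes> b b'\<close>, extended bilinearly.\<close>

definition tensor2_mult ::
    "('k::field \<Rightarrow> 'h \<Rightarrow> 'h) \<Rightarrow> ('k, 'h::ring_1) tensor2 \<Rightarrow> ('k, 'h) tensor2 \<Rightarrow> ('k, 'h) tensor2"
  where "tensor2_mult s u v = tensor2_class s
    (lin_ext fscale (\<lambda>(a, b). lin_ext fscale (\<lambda>(a', b'). gen (a * a', b * b')) (rep v)) (rep u))"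

text \<open>The linear map \<open>H \<otimes> H \<rightarrow> V\<close>, \<open>a \<otimes> b \<mapsto> f (a, b)\<close> induced by a bilinear map \<open>f\<close> into a
  vector space \<open>V\<close> with scalar multiplication \<open>t\<close>.\<close>

definition tensor2_lift ::
    "('k::field \<Rightarrow> 'v \<Rightarrow> 'v) \<Rightarrow> ('h \<times> 'h \<Rightarrow> 'v) \<Rightarrow> ('k, 'h::ab_group_add) tensor2 \<Rightarrow> 'v::ab_group_add"
  where "tensor2_lift t f u = lin_ext t f (rep u)"

text \<open>The maps \<open>\<Delta> \<otimes> id\<close> and \<open>id \<otimes> \<Delta>\<close> from \<open>H \<otimes> H\<close> to \<open>H \<otimes> H \<otimes> H\<close>.\<close>

definition comult_id ::
    "('k::field \<Rightarrow> 'h \<Rightarrow> 'h) \<Rightarrow> ('h \<Rightarrow> ('k, 'h::ab_group_add) tensor2) \<Rightarrow> ('k, 'h) tensor2 \<Rightarrow> ('k, 'h) tensor3"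
  where "comult_id s \<Delta> u = tensor3_class s
    (lin_ext fscale (\<lambda>(a, b). lin_ext fscale (\<lambda>(a', a''). gen (a', a'', b)) (rep (\<Delta> a))) (rep u))"

definition id_comult ::
    "('k::field \<Rightarrow> 'h \<Rightarrow> 'h) \<Rightarrow> ('h \<Rightarrow> ('k, 'h::ab_group_add) tensor2) \<Rightarrow> ('k, 'h) tensor2 \<Rightarrow> ('k, 'h) tensor3"
  where "id_comult s \<Delta> u = tensor3_class s
    (lin_ext fscale (\<lambda>(a, b). lin_ext fscale (\<lambda>(b', b''). gen (a, b', b'')) (rep (\<Delta> b))) (rep u))"

text \<open>The image of \<open>A \<otimes> B\<close> in \<open>H \<otimes> H\<close>, for subspaces \<open>A\<close> and \<open>B\<close> of \<open>H\<close>.\<close>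

definition tensor2_sub ::
    "('k::field \<Rightarrow> 'h \<Rightarrow> 'h) \<Rightarrow> 'h set \<Rightarrow> 'h set \<Rightarrow> ('k, 'h::ab_group_add) tensor2 set"
  where "tensor2_sub s A B =
    tensor2_class s ` module.span fscale {gen (a, b) | a b. a \<in> A \<and> b \<in> B}"

subsection \<open>Independence of representatives\<close>

lemma lookup_fscale: "Poly_Mapping.lookup (fscale c p) x = c * Poly_Mapping.lookup p x"
  unfolding fscale_def by (simp add: Poly_Mapping.map.rep_eq when_def)

lemma vector_space_fscale: "vector_space (fscale :: 'k::field \<Rightarrow> ('x \<Rightarrow>\<^sub>0 'k) \<Rightarrow> _)"
  by unfold_locales
    (auto intro!: poly_mapping_eqI simp: lookup_fscale lookup_add algebra_simps)

lemma lin_ext_superset: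
  assumes "vector_space s" "finite X" "Poly_Mapping.keys p \<subseteq> X"
  shows "lin_ext s f p = (\<Sum>x\<in>X. s (Poly_Mapping.lookup p x) (f x))"
proof -
  interpret vector_space s by fact
  show ?thesis unfolding lin_ext_def
    by (rule sum.mono_neutral_left) (use assms in \<open>auto simp: in_keys_iff\<close>)
qed

lemma linear_lin_ext:
  assumes "vector_space s"
  shows "Vector_Spaces.linear fscale s (lin_ext s f)"
proof -
  interpret V: vector_space s by fact
  interpret F: vector_space fscale by (rule vector_space_fscale)
  show ?thesis
  proof unfold_locales
    fix p q :: "'c \<Rightarrow>\<^sub>0 'a" and c
    let ?X = "Poly_Mapping.keys p \<union> Poly_Mapping.keys q"
    show "lin_ext s f (p + q) = lin_ext s f p + lin_ext s f q"
      using keys_add[of p q]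
      by (simp add: lin_ext_superset[OF assms, of ?X] lookup_add V.scale_left_distrib sum.distrib)
    have "Poly_Mapping.keys (fscale c p) \<subseteq> Poly_Mapping.keys p"
      by (auto simp: in_keys_iff lookup_fscale)
    then show "lin_ext s f (fscale c p) = s c (lin_ext s f p)"
      by (simp add: lin_ext_superset[OF assms, of "Poly_Mapping.keys p"] lookup_fscale
          V.scale_sum_right)
  qed
qed

lemma lin_ext_gen:
  assumes "vector_space s"
  shows "lin_ext s f (gen x) = f x"
proof -
  interpret vector_space s by fact
  show ?thesis by (simp add: lin_ext_def)
qed

lemma coset_eq_iff:
  assumes "vector_space s" "module.subspace s N"
  shows "coset N x = coset N y \<longleftrightarrow> x - y \<in> N"
proof -
  interpret vector_space s by fact
  have N: "0 \<in> N" "\<And>a b. a \<in> N \<Longrightarrow> b \<in> N \<Longrightarrow> a + b \<in> N" "\<And>a b. a \<in> N \<Longrightarrow> b \<in> N \<Longrightarrow> a - b \<in> N"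
    using assms(2) by (auto intro: subspace_0 subspace_add subspace_diff)
  show ?thesis
  proof
    assume "coset N x = coset N y"
    moreover have "x \<in> coset N x" using N(1) by (auto simp: coset_def intro!: exI[of _ 0])
    ultimately have "x \<in> coset N y" by simp
    then show "x - y \<in> N" by (auto simp: coset_def)
  next
    assume *: "x - y \<in> N"
    have "x + n = y + ((x - y) + n)" "y + n = x + (n - (x - y))" for n by auto
    with * N(2,3) show "coset N x = coset N y" unfolding coset_def by blast
  qed
qed

lemma rep_coset:
  assumes "vector_space s" "module.subspace s N"
  shows "rep (coset N x) - x \<in> N"
proof -
  interpret vector_space s by fact
  have "x \<in> coset N x"
    using assms(2) by (auto simp: coset_def intro!: exI[of _ 0] subspace_0)
  then have "rep (coset N x) \<in> coset N x" unfolding rep_def by (rule someI)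
  then show ?thesis by (auto simp: coset_def)
qed

lemma subspace_tensor2_rel: "module.subspace fscale (tensor2_rel s)"
proof -
  interpret F: vector_space fscale by (rule vector_space_fscale)
  show ?thesis unfolding tensor2_rel_def by (rule F.subspace_span)
qed

lemma subspace_tensor3_rel: "module.subspace fscale (tensor3_rel s)"
proof -
  interpret F: vector_space fscale by (rule vector_space_fscale)
  show ?thesis unfolding tensor3_rel_def by (rule F.subspace_span)
qed

lemma tensor2_class_eq_iff: "tensor2_class s p = tensor2_class s q \<longleftrightarrow> p - q \<in> tensor2_rel s"
  unfolding tensor2_class_def by (rule coset_eq_iff[OF vector_space_fscale subspace_tensor2_rel])

lemma tensor3_class_eq_iff: "tensor3_class s p = tensor3_class s q \<longleftrightarrow> p - q \<in> tensor3_rel s"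
  unfolding tensor3_class_def by (rule coset_eq_iff[OF vector_space_fscale subspace_tensor3_rel])

lemma rep_tensor2_class: "rep (tensor2_class s p) - p \<in> tensor2_rel s"
  unfolding tensor2_class_def by (rule rep_coset[OF vector_space_fscale subspace_tensor2_rel])

lemma tensor2_class_rep: "u \<in> tensor2_space s \<Longrightarrow> tensor2_class s (rep u) = u"
  using rep_tensor2_class tensor2_class_eq_iff
  by (fastforce simp: tensor2_space_def quotient_space_def tensor2_class_def[symmetric])

lemma tensor2_add_class:
  "tensor2_add s (tensor2_class s p) (tensor2_class s q) = tensor2_class s (p + q)"
proof -
  interpret F: vector_space fscale by (rule vector_space_fscale)
  have "(rep (tensor2_class s p) - p) + (rep (tensor2_class s q) - q) \<in> tensor2_rel s"
    by (intro F.subspace_add subspace_tensor2_rel rep_tensor2_class)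
  then show ?thesis by (simp add: tensor2_add_def tensor2_class_eq_iff algebra_simps)
qed

lemma tensor2_scale_class:
  "tensor2_scale s c (tensor2_class s p) = tensor2_class s (fscale c p)"
proof -
  interpret F: vector_space fscale by (rule vector_space_fscale)
  have "fscale c (rep (tensor2_class s p) - p) \<in> tensor2_rel s"
    by (intro F.subspace_scale subspace_tensor2_rel rep_tensor2_class)
  then show ?thesis by (simp add: tensor2_scale_def tensor2_class_eq_iff F.scale_right_diff_distrib)
qed

text \<open>A function that is bilinear modulo a subspace maps the bilinearity relations into it.\<close>

lemma lin_ext_tensor2_rel:
  fixes s :: "'k::field \<Rightarrow> 'h \<Rightarrow> 'h::ab_group_add" and f :: "'h \<times> 'h \<Rightarrow> 'v::ab_group_add"
  assumes "vector_space t" "module.subspace t N"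
    and "\<And>a a' b. f (a + a', b) - f (a, b) - f (a', b) \<in> N"
    and "\<And>a b b'. f (a, b + b') - f (a, b) - f (a, b') \<in> N"
    and "\<And>c a b. f (s c a, b) - t c (f (a, b)) \<in> N"
    and "\<And>c a b. f (a, s c b) - t c (f (a, b)) \<in> N"
    and "p \<in> tensor2_rel s"
  shows "lin_ext t f p \<in> N"
proof -
  interpret F: vector_space fscale by (rule vector_space_fscale)
  interpret V: vector_space t by fact
  interpret L: Vector_Spaces.linear fscale t "lin_ext t f" by (rule linear_lin_ext) fact
  show ?thesis
    using assms(7) unfolding tensor2_rel_def
  proof (induction rule: F.span_induct)
    case base
    show ?case using L.subspace_vimage[OF assms(2)] by (simp add: vimage_def)
  next
    case (step p)
    then show ?case using assms(3-6)
      by (auto simp: L.diff L.scale lin_ext_gen[OF assms(1)])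
  qed
qed

lemma tensor2_lift_class:
  fixes s :: "'k::field \<Rightarrow> 'h \<Rightarrow> 'h::ab_group_add" and f :: "'h \<times> 'h \<Rightarrow> 'v::ab_group_add"
  assumes "vector_space t"
    and "\<And>a a' b. f (a + a', b) = f (a, b) + f (a', b)"
    and "\<And>a b b'. f (a, b + b') = f (a, b) + f (a, b')"
    and "\<And>c a b. f (s c a, b) = t c (f (a, b))"
    and "\<And>c a b. f (a, s c b) = t c (f (a, b))"
  shows "tensor2_lift t f (tensor2_class s p) = lin_ext t f p"
proof -
  interpret V: vector_space t by fact
  interpret L: Vector_Spaces.linear fscale t "lin_ext t f" by (rule linear_lin_ext) fact
  have "lin_ext t f (rep (tensor2_class s p) - p) \<in> {0}"
    by (rule lin_ext_tensor2_rel[where s = s])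
      (simp_all add: assms rep_tensor2_class)
  then show ?thesis by (simp add: tensor2_lift_def L.diff)
qed

text \<open>A pointwise congruence of functions extends to their linear extensions.\<close>

lemma lin_ext_in_subspace:
  assumes "vector_space t" "module.subspace t N" "\<And>x. f x \<in> N"
  shows "lin_ext t f p \<in> N"
proof -
  interpret V: vector_space t by fact
  show ?thesis unfolding lin_ext_def
    by (intro V.subspace_sum V.subspace_scale assms)
qed

lemma lin_ext_fun_diff:
  assumes "vector_space t"
  shows "lin_ext t f p - lin_ext t g p = lin_ext t (\<lambda>x. f x - g x) p"
proof -
  interpret V: vector_space t by fact
  show ?thesis by (simp add: lin_ext_def sum_subtractf V.scale_right_diff_distrib)
qed

lemma lin_ext_fun_scale:
  assumes "vector_space t"
  shows "t c (lin_ext t g p) = lin_ext t (\<lambda>x. t c (g x)) p"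
proof -
  interpret V: vector_space t by fact
  show ?thesis by (simp add: lin_ext_def V.scale_sum_right mult.commute)
qed

lemma tensor2_rel_base:
  "gen (a + a', b) - gen (a, b) - gen (a', b) \<in> tensor2_rel s"
  "gen (a, b + b') - gen (a, b) - gen (a, b') \<in> tensor2_rel s"
  "gen (s c a, b) - fscale c (gen (a, b)) \<in> tensor2_rel s"
  "gen (a, s c b) - fscale c (gen (a, b)) \<in> tensor2_rel s"
proof -
  interpret F: vector_space fscale by (rule vector_space_fscale)
  show "gen (a + a', b) - gen (a, b) - gen (a', b) \<in> tensor2_rel s"
    unfolding tensor2_rel_def
    by (rule F.span_base, rule UnI1, rule UnI1, rule UnI1, intro CollectI exI conjI, rule refl, simp)
  show "gen (a, b + b') - gen (a, b) - gen (a, b') \<in> tensor2_rel s"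
    unfolding tensor2_rel_def
    by (rule F.span_base, rule UnI1, rule UnI1, rule UnI2, intro CollectI exI conjI, rule refl, simp)
  show "gen (s c a, b) - fscale c (gen (a, b)) \<in> tensor2_rel s"
    unfolding tensor2_rel_def
    by (rule F.span_base, rule UnI1, rule UnI2, intro CollectI exI conjI, rule refl, simp)
  show "gen (a, s c b) - fscale c (gen (a, b)) \<in> tensor2_rel s"
    unfolding tensor2_rel_def
    by (rule F.span_base, rule UnI2, intro CollectI exI conjI, rule refl, simp)
qed

lemma tensor3_rel_base:
  "gen (a + a', b, d) - gen (a, b, d) - gen (a', b, d) \<in> tensor3_rel s"
  "gen (a, b + b', d) - gen (a, b, d) - gen (a, b', d) \<in> tensor3_rel s"
  "gen (a, b, d + d') - gen (a, b, d) - gen (a, b, d') \<in> tensor3_rel s"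
  "gen (s c a, b, d) - fscale c (gen (a, b, d)) \<in> tensor3_rel s"
  "gen (a, s c b, d) - fscale c (gen (a, b, d)) \<in> tensor3_rel s"
  "gen (a, b, s c d) - fscale c (gen (a, b, d)) \<in> tensor3_rel s"
proof -
  interpret F: vector_space fscale by (rule vector_space_fscale)
  show "gen (a + a', b, d) - gen (a, b, d) - gen (a', b, d) \<in> tensor3_rel s"
    unfolding tensor3_rel_def
    by (rule F.span_base, rule UnI1, rule UnI1, rule UnI1, rule UnI1, rule UnI1, intro CollectI exI conjI, rule refl, simp)
  show "gen (a, b + b', d) - gen (a, b, d) - gen (a, b', d) \<in> tensor3_rel s"
    unfolding tensor3_rel_def
    by (rule F.span_base, rule UnI1, rule UnI1, rule UnI1, rule UnI1, rule UnI2, intro CollectI exI conjI, rule refl, simp)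
  show "gen (a, b, d + d') - gen (a, b, d) - gen (a, b, d') \<in> tensor3_rel s"
    unfolding tensor3_rel_def
    by (rule F.span_base, rule UnI1, rule UnI1, rule UnI1, rule UnI2, intro CollectI exI conjI, rule refl, simp)
  show "gen (s c a, b, d) - fscale c (gen (a, b, d)) \<in> tensor3_rel s"
    unfolding tensor3_rel_def
    by (rule F.span_base, rule UnI1, rule UnI1, rule UnI2, intro CollectI exI conjI, rule refl, simp)
  show "gen (a, s c b, d) - fscale c (gen (a, b, d)) \<in> tensor3_rel s"
    unfolding tensor3_rel_def
    by (rule F.span_base, rule UnI1, rule UnI2, intro CollectI exI conjI, rule refl, simp)
  show "gen (a, b, s c d) - fscale c (gen (a, b, d)) \<in> tensor3_rel s"
    unfolding tensor3_rel_def
    by (rule F.span_base, rule UnI2, intro CollectI exI conjI, rule refl, simp)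
qed


section \<open>Hopf algebras\<close>

text \<open>
  The axiom \<open>0 \<noteq> 1\<close> of the class \<open>ring_1\<close> is no restriction, since
  the counit of a bialgebra satisfies \<open>\<epsilon> 1 = 1 \<noteq> 0\<close>.
\<close>

locale unital_algebra = vector_space scale
  for scale :: "'k::field \<Rightarrow> 'h::ring_1 \<Rightarrow> 'h" (infixr \<open>*s\<close> 75) +
  assumes scale_mult_left: "(c *s x) * y = c *s (x * y)"
    and scale_mult_right: "x * (c *s y) = c *s (x * y)"

locale coalgebra = vector_space scale
  for scale :: "'k::field \<Rightarrow> 'h::ab_group_add \<Rightarrow> 'h" (infixr \<open>*s\<close> 75) +
  fixes \<Delta> :: "'h \<Rightarrow> ('k, 'h) tensor2" and \<epsilon> :: "'h \<Rightarrow> 'k"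
  assumes comult_in: "\<Delta> x \<in> tensor2_space scale"
    and comult_add: "\<Delta> (x + y) = tensor2_add scale (\<Delta> x) (\<Delta> y)"
    and comult_scale: "\<Delta> (c *s x) = tensor2_scale scale c (\<Delta> x)"
    and counit_linear: "Vector_Spaces.linear scale (*) \<epsilon>"
    and coassoc: "comult_id scale \<Delta> (\<Delta> x) = id_comult scale \<Delta> (\<Delta> x)"
    and counit_left: "tensor2_lift scale (\<lambda>(a, b). \<epsilon> a *s b) (\<Delta> x) = x"
    and counit_right: "tensor2_lift scale (\<lambda>(a, b). \<epsilon> b *s a) (\<Delta> x) = x"

locale bialgebra = unital_algebra scale + coalgebra scale \<Delta> \<epsilon>
  for scale :: "'k::field \<Rightarrow> 'h::ring_1 \<Rightarrow> 'h" (infixr \<open>*s\<close> 75)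
    and \<Delta> :: "'h \<Rightarrow> ('k, 'h) tensor2" and \<epsilon> :: "'h \<Rightarrow> 'k" +
  assumes comult_mult: "\<Delta> (x * y) = tensor2_mult scale (\<Delta> x) (\<Delta> y)"
    and comult_one: "\<Delta> 1 = tensor2_class scale (gen (1, 1))"
    and counit_mult: "\<epsilon> (x * y) = \<epsilon> x * \<epsilon> y"
    and counit_one: "\<epsilon> 1 = 1"

locale hopf_algebra = bialgebra scale \<Delta> \<epsilon>
  for scale :: "'k::field \<Rightarrow> 'h::ring_1 \<Rightarrow> 'h" (infixr \<open>*s\<close> 75)
    and \<Delta> :: "'h \<Rightarrow> ('k, 'h) tensor2" and \<epsilon> :: "'h \<Rightarrow> 'k" +
  fixes S :: "'h \<Rightarrow> 'h"
  assumes antipode_linear: "Vector_Spaces.linear scale scale S"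
    and antipode_left: "tensor2_lift scale (\<lambda>(a, b). S a * b) (\<Delta> x) = \<epsilon> x *s 1"
    and antipode_right: "tensor2_lift scale (\<lambda>(a, b). a * S b) (\<Delta> x) = \<epsilon> x *s 1"


subsection \<open>Independence of representatives\<close>

text \<open>
  For a linear \<open>\<Delta>\<close>, the values of \<open>\<Delta> \<otimes> id\<close> and \<open>id \<otimes> \<Delta>\<close> can be computed on any representative
  of the argument.
\<close>

context coalgebra
begin

lemma rep_comult_add: "rep (\<Delta> (x + y)) - rep (\<Delta> x) - rep (\<Delta> y) \<in> tensor2_rel scale"
  using rep_tensor2_class[of scale "rep (\<Delta> x) + rep (\<Delta> y)"]
  by (simp add: comult_add tensor2_add_def algebra_simps)

lemma rep_comult_scale: "rep (\<Delta> (c *s x)) - fscale c (rep (\<Delta> x)) \<in> tensor2_rel scale"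
  using rep_tensor2_class[of scale "fscale c (rep (\<Delta> x))"]
  by (simp add: comult_scale tensor2_scale_def)

lemma comult_id_class:
  "comult_id scale \<Delta> (tensor2_class scale p) = tensor3_class scale
    (lin_ext fscale (\<lambda>(a, b). lin_ext fscale (\<lambda>(a', a''). gen (a', a'', b)) (rep (\<Delta> a))) p)"
proof -
  note V = vector_space_fscale
  interpret F2: vector_space "fscale :: _ \<Rightarrow> ('h \<times> 'h \<Rightarrow>\<^sub>0 'k) \<Rightarrow> _" by (rule V)
  interpret F3: vector_space "fscale :: _ \<Rightarrow> ('h \<times> 'h \<times> 'h \<Rightarrow>\<^sub>0 'k) \<Rightarrow> _" by (rule V)
  let ?T = "\<lambda>b. lin_ext fscale (\<lambda>(a', a''). gen (a', a'', b)) :: _ \<Rightarrow> ('h \<times> 'h \<times> 'h \<Rightarrow>\<^sub>0 'k)"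
  let ?g = "\<lambda>(a, b). ?T b (rep (\<Delta> a))"
  interpret T: Vector_Spaces.linear fscale fscale "?T b" for b by (rule linear_lin_ext[OF V])
  interpret G: Vector_Spaces.linear fscale fscale "lin_ext fscale ?g" by (rule linear_lin_ext[OF V])
  have T: "?T b q \<in> tensor3_rel scale" if "q \<in> tensor2_rel scale" for b q
    by (rule lin_ext_tensor2_rel[OF V subspace_tensor3_rel _ _ _ _ that])
      (simp_all add: tensor3_rel_base)
  have "lin_ext fscale ?g (rep (tensor2_class scale p) - p) \<in> tensor3_rel scale"
  proof (rule lin_ext_tensor2_rel[OF V subspace_tensor3_rel _ _ _ _ rep_tensor2_class])
    fix a a' b b' c
    show "?g (a + a', b) - ?g (a, b) - ?g (a', b) \<in> tensor3_rel scale"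
      using T[OF rep_comult_add] by (simp add: T.diff)
    show "?g (c *s a, b) - fscale c (?g (a, b)) \<in> tensor3_rel scale"
      using T[OF rep_comult_scale] by (simp add: T.diff T.scale)
    show "?g (a, b + b') - ?g (a, b) - ?g (a, b') \<in> tensor3_rel scale"
      by (simp add: lin_ext_fun_diff[OF V])
        (rule lin_ext_in_subspace[OF V subspace_tensor3_rel], simp add: case_prod_beta tensor3_rel_base)
    show "?g (a, c *s b) - fscale c (?g (a, b)) \<in> tensor3_rel scale"
      by (simp add: lin_ext_fun_diff[OF V] lin_ext_fun_scale[OF V])
        (rule lin_ext_in_subspace[OF V subspace_tensor3_rel], simp add: case_prod_beta tensor3_rel_base)
  qed
  then show ?thesis
    by (simp add: comult_id_def tensor3_class_eq_iff G.diff)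
qed

lemma id_comult_class:
  "id_comult scale \<Delta> (tensor2_class scale p) = tensor3_class scale
    (lin_ext fscale (\<lambda>(a, b). lin_ext fscale (\<lambda>(b', b''). gen (a, b', b'')) (rep (\<Delta> b))) p)"
proof -
  note V = vector_space_fscale
  interpret F2: vector_space "fscale :: _ \<Rightarrow> ('h \<times> 'h \<Rightarrow>\<^sub>0 'k) \<Rightarrow> _" by (rule V)
  interpret F3: vector_space "fscale :: _ \<Rightarrow> ('h \<times> 'h \<times> 'h \<Rightarrow>\<^sub>0 'k) \<Rightarrow> _" by (rule V)
  let ?T = "\<lambda>a. lin_ext fscale (\<lambda>(b', b''). gen (a, b', b'')) :: _ \<Rightarrow> ('h \<times> 'h \<times> 'h \<Rightarrow>\<^sub>0 'k)"
  let ?g = "\<lambda>(a, b). ?T a (rep (\<Delta> b))"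
  interpret T: Vector_Spaces.linear fscale fscale "?T b" for b by (rule linear_lin_ext[OF V])
  interpret G: Vector_Spaces.linear fscale fscale "lin_ext fscale ?g" by (rule linear_lin_ext[OF V])
  have T: "?T b q \<in> tensor3_rel scale" if "q \<in> tensor2_rel scale" for b q
    by (rule lin_ext_tensor2_rel[OF V subspace_tensor3_rel _ _ _ _ that])
      (simp_all add: tensor3_rel_base)
  have "lin_ext fscale ?g (rep (tensor2_class scale p) - p) \<in> tensor3_rel scale"
  proof (rule lin_ext_tensor2_rel[OF V subspace_tensor3_rel _ _ _ _ rep_tensor2_class])
    fix a a' b b' c
    show "?g (a, b + b') - ?g (a, b) - ?g (a, b') \<in> tensor3_rel scale"
      using T[OF rep_comult_add] by (simp add: T.diff)
    show "?g (a, c *s b) - fscale c (?g (a, b)) \<in> tensor3_rel scale"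
      using T[OF rep_comult_scale] by (simp add: T.diff T.scale)
    show "?g (a + a', b) - ?g (a, b) - ?g (a', b) \<in> tensor3_rel scale"
      by (simp add: lin_ext_fun_diff[OF V])
        (rule lin_ext_in_subspace[OF V subspace_tensor3_rel], clarsimp simp: tensor3_rel_base)
    show "?g (c *s a, b) - fscale c (?g (a, b)) \<in> tensor3_rel scale"
      by (simp add: lin_ext_fun_diff[OF V] lin_ext_fun_scale[OF V])
        (rule lin_ext_in_subspace[OF V subspace_tensor3_rel], clarsimp simp: tensor3_rel_base)
  qed
  then show ?thesis
    by (simp add: id_comult_def tensor3_class_eq_iff G.diff)
qed

end

text \<open>The product of \<open>H \<otimes> H\<close> can be computed on any representatives.\<close>

lemma (in unital_algebra) tensor2_mult_class:
  "tensor2_mult scale (tensor2_class scale p) (tensor2_class scale q) = tensor2_class scale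
    (lin_ext fscale (\<lambda>(a, b). lin_ext fscale (\<lambda>(a', b'). gen (a * a', b * b')) q) p)"
proof -
  note V = vector_space_fscale
  interpret F2: vector_space "fscale :: _ \<Rightarrow> ('h \<times> 'h \<Rightarrow>\<^sub>0 'k) \<Rightarrow> _" by (rule V)
  let ?T = "\<lambda>a b. lin_ext fscale (\<lambda>(a', b'). gen (a * a', b * b')) :: _ \<Rightarrow> ('h \<times> 'h \<Rightarrow>\<^sub>0 'k)"
  let ?g = "\<lambda>r (a, b). ?T a b r"
  interpret T: Vector_Spaces.linear fscale fscale "?T a b" for a b by (rule linear_lin_ext[OF V])
  interpret G: Vector_Spaces.linear fscale fscale "lin_ext fscale (?g r)" for r
    by (rule linear_lin_ext[OF V])
  have T: "?T a b r \<in> tensor2_rel scale" if "r \<in> tensor2_rel scale" for a b r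
    by (rule lin_ext_tensor2_rel[OF V subspace_tensor2_rel _ _ _ _ that])
      (simp_all add: tensor2_rel_base distrib_left scale_mult_right)
  have 1: "lin_ext fscale (?g r) (rep (tensor2_class scale p) - p) \<in> tensor2_rel scale" for r
  proof (rule lin_ext_tensor2_rel[OF V subspace_tensor2_rel _ _ _ _ rep_tensor2_class])
    fix a a' b b' c
    show "?g r (a + a', b) - ?g r (a, b) - ?g r (a', b) \<in> tensor2_rel scale"
      "?g r (a, b + b') - ?g r (a, b) - ?g r (a, b') \<in> tensor2_rel scale"
      by (simp_all add: lin_ext_fun_diff[OF V])
        (rule lin_ext_in_subspace[OF V subspace_tensor2_rel],
          simp add: case_prod_beta tensor2_rel_base distrib_right)+
    show "?g r (c *s a, b) - fscale c (?g r (a, b)) \<in> tensor2_rel scale"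
      "?g r (a, c *s b) - fscale c (?g r (a, b)) \<in> tensor2_rel scale"
      by (simp_all add: lin_ext_fun_diff[OF V] lin_ext_fun_scale[OF V])
        (rule lin_ext_in_subspace[OF V subspace_tensor2_rel],
          simp add: case_prod_beta tensor2_rel_base scale_mult_left)+
  qed
  have 2: "lin_ext fscale (?g (rep (tensor2_class scale q))) p - lin_ext fscale (?g q) p
      \<in> tensor2_rel scale"
    by (subst lin_ext_fun_diff[OF V])
      (rule lin_ext_in_subspace[OF V subspace_tensor2_rel],
        simp add: case_prod_beta T.diff[symmetric] T rep_tensor2_class)
  show ?thesis
    using F2.subspace_add[OF subspace_tensor2_rel 1[of "rep (tensor2_class scale q)"] 2]
    by (simp add: tensor2_mult_def tensor2_class_eq_iff G.diff)
qed


section \<open>The poset of quotients by coideal right ideals\<close>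

text \<open>\<open>\<Delta> I \<subseteq> I \<otimes> H + H \<otimes> I\<close> and \<open>\<epsilon> I = 0\<close>.\<close>

definition coideal ::
    "('k::field \<Rightarrow> 'h \<Rightarrow> 'h) \<Rightarrow> ('h \<Rightarrow> ('k, 'h) tensor2) \<Rightarrow> ('h \<Rightarrow> 'k) \<Rightarrow> 'h::ab_group_add set \<Rightarrow> bool"
  where "coideal s \<Delta> \<epsilon> I \<longleftrightarrow>
    module.subspace s I \<and>
    (\<forall>x\<in>I. \<exists>u\<in>tensor2_sub s I UNIV. \<exists>v\<in>tensor2_sub s UNIV I. \<Delta> x = tensor2_add s u v) \<and>
    (\<forall>x\<in>I. \<epsilon> x = 0)"

definition right_ideal :: "('k::field \<Rightarrow> 'h \<Rightarrow> 'h) \<Rightarrow> 'h::ring_1 set \<Rightarrow> bool"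
  where "right_ideal s I \<longleftrightarrow> module.subspace s I \<and> (\<forall>x\<in>I. \<forall>h. x * h \<in> I)"

definition coideal_right_ideals ::
    "('k::field \<Rightarrow> 'h \<Rightarrow> 'h) \<Rightarrow> ('h \<Rightarrow> ('k, 'h) tensor2) \<Rightarrow> ('h \<Rightarrow> 'k) \<Rightarrow> 'h::ring_1 set set"
  where "coideal_right_ideals s \<Delta> \<epsilon> = {I. coideal s \<Delta> \<epsilon> I \<and> right_ideal s I}"

text \<open>\<open>le Q R\<close> reads \<open>Q \<preceq> R\<close>, so that \<open>H/J \<preceq> H/I\<close> iff \<open>I \<subseteq> J\<close>.\<close>

definition Quot_gen ::
    "('k::field \<Rightarrow> 'h \<Rightarrow> 'h) \<Rightarrow> ('h \<Rightarrow> ('k, 'h) tensor2) \<Rightarrow> ('h \<Rightarrow> 'k) \<Rightarrow> 'h::ring_1 set set gorder"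
  where "Quot_gen s \<Delta> \<epsilon> =
    \<lparr>carrier = quotient_space ` coideal_right_ideals s \<Delta> \<epsilon>,
     eq = (=),
     le = (\<lambda>Q R. \<exists>I\<in>coideal_right_ideals s \<Delta> \<epsilon>. \<exists>J\<in>coideal_right_ideals s \<Delta> \<epsilon>.
       R = quotient_space I \<and> Q = quotient_space J \<and> I \<subseteq> J)\<rparr>"


section \<open>Algebraic lattices\<close>

definition compact_element :: "('a, 'b) gorder_scheme \<Rightarrow> 'a \<Rightarrow> bool"
  where "compact_element L z \<longleftrightarrow> z \<in> carrier L \<and>
    (\<forall>A\<subseteq>carrier L. z \<sqsubseteq>\<^bsub>L\<^esub> \<Squnion>\<^bsub>L\<^esub>A \<longrightarrow> (\<exists>F\<subseteq>A. finite F \<and> z \<sqsubseteq>\<^bsub>L\<^esub> \<Squnion>\<^bsub>L\<^esub>F))"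

definition algebraic_lattice :: "('a, 'b) gorder_scheme \<Rightarrow> bool"
  where "algebraic_lattice L \<longleftrightarrow> complete_lattice L \<and>
    (\<forall>x\<in>carrier L. \<exists>A\<subseteq>Collect (compact_element L). x = \<Squnion>\<^bsub>L\<^esub>A)"

definition dually_algebraic_lattice :: "('a, 'b) gorder_scheme \<Rightarrow> bool"
  where "dually_algebraic_lattice L \<longleftrightarrow> algebraic_lattice (inv_gorder L)"

end

theory Submission
  imports Defs
begin

text \<open>
  A coideal right ideal is recovered from its quotient, as the coset of \<open>0\<close>, so
  \<open>(Quot_gen H, \<succeq>)\<close> is the poset of coideal right ideals with the reversed inclusion.
  Such ideals are closed under arbitrary sums: the conditions \<open>\<Delta> x \<in> J \<otimes> H + H \<otimes> J\<close>,
  \<open>\<epsilon> x = 0\<close> and \<open>x h \<in> J\<close> are linear in \<open>x\<close> and become weaker when \<open>J\<close> grows, so they hold on the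
  sum of a family as soon as they hold on its members. Intersections, by contrast, need not
  be coideals. Hence sums give all infima of \<open>Quot_gen H\<close>, the empty sum \<open>0\<close> gives the
  top element \<open>H/0\<close>, and a poset with all infima is a complete lattice
  (\<open>complete_lattice_Quot_gen\<close>).

  If \<open>H\<close> is finite dimensional, the dimension of the ideal is a bounded integer that strictly
  drops along strict steps up in \<open>Quot_gen H\<close>, so chains there have bounded length, and the same
  is true of the dual order. In a complete lattice with bounded chains every element is compact,
  because each supremum is already attained by a finite subset: one whose supremum has maximal
  rank (\<open>algebraic_lattice_of_rank\<close>). This applies to \<open>Quot_gen H\<close> and to its dual.
\<close>

section \<open>Lattices of finite height\<close>

lemma complete_lattice_dual:
  assumes "complete_lattice L"
  shows "complete_lattice (inv_gorder L)"
proof -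
  interpret complete_lattice L by fact
  interpret dual: partial_order "inv_gorder L" by (rule dual_order)
  show ?thesis
    by (rule dual.complete_latticeI) (simp_all add: sup_exists inf_exists)
qed

text \<open>
  Among the finite subsets of \<open>A\<close> take \<open>F\<close> with \<open>\<Squnion>F\<close> of maximal rank. Adjoining any
  \<open>a \<in> A\<close> cannot raise the rank, so \<open>a \<sqsubseteq> \<Squnion>F\<close>.
\<close>

lemma finite_subset_attains_sup:
  fixes L (structure) and d :: "'a \<Rightarrow> nat"
  assumes "complete_lattice L"
    and bounded: "\<And>x. x \<in> carrier L \<Longrightarrow> d x \<le> n"
    and strict: "\<And>x y. \<lbrakk>x \<in> carrier L; y \<in> carrier L; x \<sqsubseteq> y; x \<noteq> y\<rbrakk> \<Longrightarrow> d x < d y"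
    and A: "A \<subseteq> carrier L"
  obtains F where "F \<subseteq> A" "finite F" "\<Squnion>F = \<Squnion>A"
proof -
  interpret complete_lattice L by fact
  have closed: "\<Squnion>F \<in> carrier L" if "F \<subseteq> A" for F
    using that A by (simp add: subset_trans)
  have "\<exists>F. (F \<subseteq> A \<and> finite F) \<and> (\<forall>G. G \<subseteq> A \<and> finite G \<longrightarrow> d (\<Squnion>G) \<le> d (\<Squnion>F))"
    \<comment> \<open>the empty set is a candidate, and the rank has to be strictly bounded here\<close>
    by (rule ex_has_greatest_nat[of _ "{}" _ "Suc n"])
      (auto intro: bounded closed simp: less_Suc_eq_le)
  then obtain F where F: "F \<subseteq> A" "finite F"
    and max: "\<And>G. G \<subseteq> A \<Longrightarrow> finite G \<Longrightarrow> d (\<Squnion>G) \<le> d (\<Squnion>F)"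
    by blast
  have upper: "a \<sqsubseteq> \<Squnion>F" if a: "a \<in> A" for a
  proof -
    let ?G = "insert a F"
    have G: "?G \<subseteq> A" "?G \<subseteq> carrier L" "F \<subseteq> carrier L" using a F A by auto
    have "\<Squnion>F \<sqsubseteq> \<Squnion>?G"
      by (rule weak.sup_least) (use G closed in \<open>auto intro: weak.sup_upper\<close>)
    moreover have "\<not> d (\<Squnion>F) < d (\<Squnion>?G)"
      using max[of ?G] G(1) F(2) by simp
    ultimately have "\<Squnion>F = \<Squnion>?G"
      using strict[of "\<Squnion>F" "\<Squnion>?G"] closed[OF F(1)] closed[OF G(1)] by argo
    then show ?thesis using weak.sup_upper[of ?G a] G by simp
  qed
  have "\<Squnion>F = \<Squnion>A"
  proof (rule le_antisym)
    show "\<Squnion>F \<sqsubseteq> \<Squnion>A"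
      by (rule weak.sup_least) (use A F closed in \<open>auto intro: weak.sup_upper\<close>)
    show "\<Squnion>A \<sqsubseteq> \<Squnion>F"
      by (rule weak.sup_least) (use A F closed upper in auto)
  qed (use F closed in auto)
  with F that show ?thesis by blast
qed

lemma algebraic_lattice_of_rank:
  fixes L (structure) and d :: "'a \<Rightarrow> nat"
  assumes L: "complete_lattice L"
    and bounded: "\<And>x. x \<in> carrier L \<Longrightarrow> d x \<le> n"
    and strict: "\<And>x y. \<lbrakk>x \<in> carrier L; y \<in> carrier L; x \<sqsubseteq> y; x \<noteq> y\<rbrakk> \<Longrightarrow> d x < d y"
  shows "algebraic_lattice L"
proof -
  interpret complete_lattice L by fact
  have compact: "compact_element L x" if "x \<in> carrier L" for x
    unfolding compact_element_def
  proof (intro conjI allI impI that)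
    fix A assume "A \<subseteq> carrier L" "x \<sqsubseteq> \<Squnion>A"
    then show "\<exists>F\<subseteq>A. finite F \<and> x \<sqsubseteq> \<Squnion>F"
      by (metis finite_subset_attains_sup[of L d n A] L bounded strict)
  qed
  have "x = \<Squnion>{x}" if "x \<in> carrier L" for x
    by (rule le_antisym) (use that in \<open>auto intro: weak.sup_upper weak.sup_least\<close>)
  with compact L show ?thesis
    unfolding algebraic_lattice_def by (metis empty_subsetI insert_subset mem_Collect_eq)
qed


section \<open>Sums of coideal right ideals\<close>

lemma tensor2_sub_mono:
  assumes "A \<subseteq> A'" "B \<subseteq> B'"
  shows "tensor2_sub s A B \<subseteq> tensor2_sub s A' B'"
proof -
  interpret F: vector_space fscale by (rule vector_space_fscale)
  show ?thesis
    unfolding tensor2_sub_def by (intro image_mono F.span_mono) (use assms in blast)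
qed

text \<open>
  Addition of tensors is defined through chosen representatives. On classes it is addition
  in the free vector space, so the vector space laws needed below are read off there.
\<close>

lemma tensor2_sub_add:
  assumes "u \<in> tensor2_sub s A B" "v \<in> tensor2_sub s A B"
  shows "tensor2_add s u v \<in> tensor2_sub s A B"
proof -
  interpret F: vector_space fscale by (rule vector_space_fscale)
  show ?thesis
    using assms unfolding tensor2_sub_def by (auto simp: tensor2_add_class intro: F.span_add)
qed

lemma tensor2_sub_scale:
  assumes "u \<in> tensor2_sub s A B"
  shows "tensor2_scale s c u \<in> tensor2_sub s A B"
proof -
  interpret F: vector_space fscale by (rule vector_space_fscale)
  show ?thesis
    using assms unfolding tensor2_sub_def by (auto simp: tensor2_scale_class intro: F.span_scale)
qed

lemma tensor2_sub_zero: "tensor2_class s 0 \<in> tensor2_sub s A B"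
proof -
  interpret F: vector_space fscale by (rule vector_space_fscale)
  show ?thesis unfolding tensor2_sub_def by (auto intro: F.span_zero)
qed

lemma tensor2_sub_classE:
  assumes "u \<in> tensor2_sub s A B"
  obtains p where "u = tensor2_class s p"
  using assms unfolding tensor2_sub_def by blast

lemma tensor2_add_interchange:
  assumes "u \<in> tensor2_sub s A B" "u' \<in> tensor2_sub s A B"
    and "v \<in> tensor2_sub s C D" "v' \<in> tensor2_sub s C D"
  shows "tensor2_add s (tensor2_add s u v) (tensor2_add s u' v')
    = tensor2_add s (tensor2_add s u u') (tensor2_add s v v')"
  using assms by (elim tensor2_sub_classE) (simp add: tensor2_add_class algebra_simps)

lemma tensor2_scale_add:
  assumes "u \<in> tensor2_sub s A B" "v \<in> tensor2_sub s C D"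
  shows "tensor2_scale s c (tensor2_add s u v)
    = tensor2_add s (tensor2_scale s c u) (tensor2_scale s c v)"
proof -
  interpret F: vector_space fscale by (rule vector_space_fscale)
  show ?thesis
    using assms
    by (elim tensor2_sub_classE)
      (simp add: tensor2_add_class tensor2_scale_class F.scale_right_distrib)
qed

context coalgebra
begin

lemma comult_zero: "\<Delta> 0 = tensor2_class scale 0"
proof -
  interpret F: vector_space fscale by (rule vector_space_fscale)
  have "\<Delta> 0 = tensor2_scale scale 0 (\<Delta> 0)" using comult_scale[of 0 0] by simp
  then show ?thesis by (simp add: tensor2_scale_def)
qed

text \<open>
  Since \<open>\<Delta>\<close> is linear, the coideal condition for a span needs to be tested only on
  generators.
\<close>

lemma subspace_comult_vimage:
  "subspace {x. \<exists>u\<in>tensor2_sub scale J UNIV. \<exists>v\<in>tensor2_sub scale UNIV J.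
    \<Delta> x = tensor2_add scale u v}" (is "subspace ?K")
proof (rule subspaceI)
  have "\<Delta> 0 = tensor2_add scale (tensor2_class scale 0) (tensor2_class scale 0)"
    by (simp add: comult_zero tensor2_add_class)
  then show "0 \<in> ?K" using tensor2_sub_zero by blast
next
  fix x y assume "x \<in> ?K" "y \<in> ?K"
  then obtain u v u' v' where
    *: "u \<in> tensor2_sub scale J UNIV" "u' \<in> tensor2_sub scale J UNIV"
      "v \<in> tensor2_sub scale UNIV J" "v' \<in> tensor2_sub scale UNIV J"
    and "\<Delta> x = tensor2_add scale u v" "\<Delta> y = tensor2_add scale u' v'"
    by blast
  then have "\<Delta> (x + y) = tensor2_add scale (tensor2_add scale u u') (tensor2_add scale v v')"
    by (simp add: comult_add tensor2_add_interchange[OF *])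
  with * show "x + y \<in> ?K" using tensor2_sub_add by blast
next
  fix c x assume "x \<in> ?K"
  then obtain u v where
    *: "u \<in> tensor2_sub scale J UNIV" "v \<in> tensor2_sub scale UNIV J"
    and "\<Delta> x = tensor2_add scale u v"
    by blast
  then have "\<Delta> (c *s x) = tensor2_add scale (tensor2_scale scale c u) (tensor2_scale scale c v)"
    by (simp add: comult_scale tensor2_scale_add[OF *])
  with * show "c *s x \<in> ?K" using tensor2_sub_scale by blast
qed

lemma coideal_span_Union:
  assumes "\<And>I. I \<in> C \<Longrightarrow> coideal scale \<Delta> \<epsilon> I"
  shows "coideal scale \<Delta> \<epsilon> (span (\<Union>C))"
proof -
  interpret E: Vector_Spaces.linear scale "(*)" \<epsilon> by (rule counit_linear)
  let ?J = "span (\<Union>C)"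
  let ?K = "{x. \<exists>u\<in>tensor2_sub scale ?J UNIV. \<exists>v\<in>tensor2_sub scale UNIV ?J.
    \<Delta> x = tensor2_add scale u v}"
  have "I \<subseteq> ?K" if "I \<in> C" for I
  proof -
    have "I \<subseteq> ?J" using that span_superset by blast
    then have "tensor2_sub scale I UNIV \<subseteq> tensor2_sub scale ?J UNIV"
      "tensor2_sub scale UNIV I \<subseteq> tensor2_sub scale UNIV ?J"
      by (simp_all add: tensor2_sub_mono)
    then show ?thesis using assms[OF that] unfolding coideal_def by blast
  qed
  then have "?J \<subseteq> ?K" by (intro span_minimal subspace_comult_vimage) blast
  moreover have "?J \<subseteq> {x. \<epsilon> x = 0}"
    by (intro span_minimal E.subspace_kernel) (use assms in \<open>auto simp: coideal_def\<close>)
  ultimately show ?thesis unfolding coideal_def using subspace_span by blast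
qed

end

lemma (in unital_algebra) right_ideal_span_Union:
  assumes "\<And>I. I \<in> C \<Longrightarrow> right_ideal scale I"
  shows "right_ideal scale (span (\<Union>C))"
proof -
  have "span (\<Union>C) \<subseteq> {x. x * h \<in> span (\<Union>C)}" for h
  proof (rule span_minimal)
    show "\<Union>C \<subseteq> {x. x * h \<in> span (\<Union>C)}"
      using assms unfolding right_ideal_def by (blast intro: span_base)
    show "subspace {x. x * h \<in> span (\<Union>C)}"
      by (rule subspaceI)
        (auto simp: distrib_right scale_mult_left intro: span_zero span_add span_scale)
  qed
  then show ?thesis unfolding right_ideal_def using subspace_span by blast
qed


section \<open>The lattice of quotients\<close>

text \<open>A subspace is the coset of \<open>0\<close>, the only member of its quotient that contains \<open>0\<close>.\<close>

lemma (in vector_space) quotient_space_inject: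
  assumes "subspace I" "subspace J" "quotient_space I = quotient_space J"
  shows "I = J"
proof -
  have "coset I 0 \<in> quotient_space J"
    using assms(3) unfolding quotient_space_def by blast
  then obtain x where x: "coset I 0 = coset J x" unfolding quotient_space_def by blast
  have "0 \<in> coset J x"
    unfolding x[symmetric] using subspace_0[OF assms(1)] by (auto simp: coset_def)
  then obtain n where "n \<in> J" "0 = x + n" unfolding coset_def by blast
  then have "x - 0 \<in> J" using subspace_neg[OF assms(2)] by (simp add: eq_neg_iff_add_eq_0[symmetric])
  then have "coset J x = coset J 0"
    using coset_eq_iff[OF vector_space_axioms assms(2)] by blast
  with x show ?thesis by (simp add: coset_def)
qed

context bialgebra
begin

abbreviation "CRI \<equiv> coideal_right_ideals scale \<Delta> \<epsilon>"

lemma CRI_subspace: "I \<in> CRI \<Longrightarrow> subspace I"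
  by (simp add: coideal_right_ideals_def coideal_def)

lemma CRI_span_Union: "C \<subseteq> CRI \<Longrightarrow> span (\<Union>C) \<in> CRI"
  unfolding coideal_right_ideals_def
  by (blast intro: coideal_span_Union right_ideal_span_Union)

lemma inj_on_quotient_space_CRI: "inj_on quotient_space CRI"
  by (rule inj_onI) (rule quotient_space_inject[OF CRI_subspace CRI_subspace])

lemma Quot_gen_le_iff:
  assumes "I \<in> CRI" "J \<in> CRI"
  shows "quotient_space J \<sqsubseteq>\<^bsub>Quot_gen scale \<Delta> \<epsilon>\<^esub> quotient_space I \<longleftrightarrow> I \<subseteq> J"
proof -
  have "quotient_space I = quotient_space I' \<longleftrightarrow> I = I'" if "I \<in> CRI" "I' \<in> CRI" for I I'
    by (rule inj_on_eq_iff[OF inj_on_quotient_space_CRI that])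
  with assms show ?thesis unfolding Quot_gen_def by auto
qed

lemma carrier_Quot_gen: "carrier (Quot_gen scale \<Delta> \<epsilon>) = quotient_space ` CRI"
  by (simp add: Quot_gen_def)

lemma eq_Quot_gen: "x .=\<^bsub>Quot_gen scale \<Delta> \<epsilon>\<^esub> y \<longleftrightarrow> x = y"
  by (simp add: Quot_gen_def)

lemma partial_order_Quot_gen: "partial_order (Quot_gen scale \<Delta> \<epsilon>)"
  by unfold_locales
    (auto simp: carrier_Quot_gen Quot_gen_le_iff eq_Quot_gen fun_eq_iff)

text \<open>
  A lower bound of the \<open>H/I\<close> is a quotient by an ideal containing all \<open>I\<close>, and the sum is the
  least of these. For \<open>C = {}\<close> this is the top element \<open>H/0\<close>.
\<close>

lemma greatest_Quot_gen:
  assumes "C \<subseteq> CRI"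
  shows "greatest (Quot_gen scale \<Delta> \<epsilon>) (quotient_space (span (\<Union>C)))
    (Lower (Quot_gen scale \<Delta> \<epsilon>) (quotient_space ` C))"
proof (rule greatest_LowerI)
  fix Q assume "Q \<in> quotient_space ` C"
  then obtain I where "I \<in> C" "Q = quotient_space I" by blast
  then show "quotient_space (span (\<Union>C)) \<sqsubseteq>\<^bsub>Quot_gen scale \<Delta> \<epsilon>\<^esub> Q"
    using assms by (auto simp: Quot_gen_le_iff CRI_span_Union subsetD intro: span_base)
next
  fix Q assume Q: "Q \<in> Lower (Quot_gen scale \<Delta> \<epsilon>) (quotient_space ` C)"
  then obtain J where J: "J \<in> CRI" "Q = quotient_space J"
    by (auto simp: Lower_def carrier_Quot_gen)
  have "I \<subseteq> J" if "I \<in> C" for I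
  proof -
    have "Q \<sqsubseteq>\<^bsub>Quot_gen scale \<Delta> \<epsilon>\<^esub> quotient_space I"
      using Q that assms by (auto simp: Lower_def carrier_Quot_gen)
    then show ?thesis using that assms J by (auto simp: Quot_gen_le_iff subset_iff)
  qed
  then have "span (\<Union>C) \<subseteq> J" by (intro span_minimal CRI_subspace J) blast
  then show "Q \<sqsubseteq>\<^bsub>Quot_gen scale \<Delta> \<epsilon>\<^esub> quotient_space (span (\<Union>C))"
    using J assms by (simp add: Quot_gen_le_iff CRI_span_Union)
qed (use assms in \<open>auto simp: carrier_Quot_gen CRI_span_Union\<close>)

lemma complete_lattice_Quot_gen: "complete_lattice (Quot_gen scale \<Delta> \<epsilon>)"
proof -
  interpret partial_order "Quot_gen scale \<Delta> \<epsilon>" by (rule partial_order_Quot_gen)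
  have inf: "\<exists>i. greatest (Quot_gen scale \<Delta> \<epsilon>) i (Lower (Quot_gen scale \<Delta> \<epsilon>) A)"
    if "A \<subseteq> carrier (Quot_gen scale \<Delta> \<epsilon>)" for A
    using that unfolding carrier_Quot_gen subset_image_iff by (blast intro: greatest_Quot_gen)
  have "\<exists>g. greatest (Quot_gen scale \<Delta> \<epsilon>) g (carrier (Quot_gen scale \<Delta> \<epsilon>))"
    using inf[of "{}"] by (simp only: Lower_empty empty_subsetI)
  then show ?thesis
    by (rule complete_lattice_criterion1) (rule inf)
qed

text \<open>
  The rank of \<open>H/I\<close> in the dual order is \<open>dim I\<close>; in the order itself it is the codimension.
\<close>

lemma algebraic_Quot_gen:
  assumes "finite_dimensional_vector_space scale B"
  shows "algebraic_lattice (Quot_gen scale \<Delta> \<epsilon>)"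
    and "dually_algebraic_lattice (Quot_gen scale \<Delta> \<epsilon>)"
proof -
  interpret FD: finite_dimensional_vector_space scale B by fact
  define d where "d Q = dim (inv_into CRI quotient_space Q)" for Q
  define n where "n = dim UNIV"
  have d: "d (quotient_space I) = dim I" if "I \<in> CRI" for I
    by (simp add: d_def inv_into_f_f[OF inj_on_quotient_space_CRI that])
  have bounded: "d Q \<le> n" for Q
    unfolding d_def n_def by (rule FD.dim_subset) simp
  have strict: "d R < d Q"
    if QR: "Q \<in> carrier (Quot_gen scale \<Delta> \<epsilon>)" "R \<in> carrier (Quot_gen scale \<Delta> \<epsilon>)"
      "Q \<sqsubseteq>\<^bsub>Quot_gen scale \<Delta> \<epsilon>\<^esub> R" "Q \<noteq> R" for Q R
  proof -
    obtain I J where IJ: "I \<in> CRI" "J \<in> CRI" "R = quotient_space I" "Q = quotient_space J"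
      using QR(1,2) unfolding carrier_Quot_gen by blast
    then have "I \<subset> J" using QR by (auto simp: Quot_gen_le_iff)
    then have "dim I < dim J"
      using IJ by (intro FD.dim_psubset) (simp add: CRI_subspace span_eq_iff[THEN iffD2])
    then show ?thesis using IJ d by simp
  qed
  show "algebraic_lattice (Quot_gen scale \<Delta> \<epsilon>)"
  proof (rule algebraic_lattice_of_rank[OF complete_lattice_Quot_gen, where d = "\<lambda>Q. n - d Q"])
    show "n - d Q < n - d R"
      if "Q \<in> carrier (Quot_gen scale \<Delta> \<epsilon>)" "R \<in> carrier (Quot_gen scale \<Delta> \<epsilon>)"
        "Q \<sqsubseteq>\<^bsub>Quot_gen scale \<Delta> \<epsilon>\<^esub> R" "Q \<noteq> R" for Q R
      using strict[OF that] bounded[of Q] by linarith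
  qed (rule diff_le_self)
  show "dually_algebraic_lattice (Quot_gen scale \<Delta> \<epsilon>)"
    unfolding dually_algebraic_lattice_def
    by (rule algebraic_lattice_of_rank[OF complete_lattice_dual[OF complete_lattice_Quot_gen],
          where d = d and n = n])
      (use bounded strict in auto)
qed

end

theorem proposition2p3:
  fixes scale :: "'k::field \<Rightarrow> 'h::ring_1 \<Rightarrow> 'h"
    and \<Delta> :: "'h \<Rightarrow> ('k, 'h) tensor2"
    and \<epsilon> :: "'h \<Rightarrow> 'k"
    and S :: "'h \<Rightarrow> 'h"
  assumes "hopf_algebra scale \<Delta> \<epsilon> S"
  shows "complete_lattice (Quot_gen scale \<Delta> \<epsilon>) \<and>
    ((\<exists>B. finite_dimensional_vector_space scale B) \<longrightarrow>
      algebraic_lattice (Quot_gen scale \<Delta> \<epsilon>) \<and>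
      dually_algebraic_lattice (Quot_gen scale \<Delta> \<epsilon>))"
proof -
  interpret hopf_algebra scale \<Delta> \<epsilon> S by fact
  show ?thesis using complete_lattice_Quot_gen algebraic_Quot_gen by blast
qed

end
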